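(* Let $\mathcal{P}^*$ be an equivalence class of $N$-polygons and let $\Gamma(t)$ ($t\in\mathcal{I}$, $\mathcal{I}\subset\mathbb{R}$ an interval) be a $C^1$-class polygonal motion in $\mathcal{P}^*$, with normal velocity $V$ and polygonal curvature $\kappa$. Then $$\frac{d}{dt}|\Gamma(t)|=\sum_{j=1}^N|\Gamma_j(t)|\,\kappa_j(t)\,V_j(t)=\int_{\Gamma(t)}\kappa(\boldsymbol{x},t)V(\boldsymbol{x},t)\,ds.$$
   Context: $\mathcal{P}$ is the set of all polygonal Jordan curves in $\mathbb{R}^2$. For an $N$-polygon $\Gamma\in\mathcal{P}$, the vertices $\boldsymbol{w}_1,\dots,\boldsymbol{w}_N$ are numbered counterclockwise (periodic index convention modulo $N$), the $j$-th edge is $\Gamma_j=\{(1-\theta)\boldsymbol{w}_{j-1}+\theta\boldsymbol{w}_j:0<\theta<1\}$ with length $|\Gamma_j|$, unit tangent $\boldsymbol{t}_j=(\boldsymbol{w}_j-\boldsymbol{w}_{j-1})/|\Gamma_j|$ and outward unit normal $\boldsymbol{n}_j$; the outer angle at $\boldsymbol{w}_j$ is $\varphi_j\in(-\pi,\pi)\setminus\{0\}$ with $\boldsymbol{n}_{j+1}\cdot\boldsymbol{n}_j=\cos\varphi_j$ and $\boldsymbol{n}_{j+1}\cdot\boldsymbol{t}_j=\sin\varphi_j$; the height of $\Gamma_j$ is $h_j:=\boldsymbol{w}_j\cdot\boldsymbol{n}_j=\boldsymbol{w}_{j-1}\cdot\boldsymbol{n}_j$; the total length is $|\Gamma|=\sum_{j=1}^N|\Gamma_j|$.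 The polygonal curvature of $\Gamma_j$ is $\kappa_j:=\eta_j/|\Gamma_j|$ with $\eta_j:=\tan(\varphi_j/2)+\tan(\varphi_{j-1}/2)$, and the polygonal curvature of $\Gamma$ is $\kappa:=\sum_{j=1}^N\kappa_j\chi_j\in L^\infty(\Gamma)$, where $\chi_j$ is the characteristic function of $\Gamma_j$ on $\Gamma$. Two polygons are equivalent if they have the same number $N$ of edges and, after suitable counterclockwise numbering, $\boldsymbol{n}_j(\Gamma)=\boldsymbol{n}_j(\Sigma)$ for all $j$. $\mathcal{P}^*=\mathcal{P}[\Gamma^*]$ is the equivalence class of a fixed $N$-polygon $\Gamma^*$, its elements being numbered so that $\boldsymbol n_j(\Gamma)=\boldsymbol n_j(\Gamma^* )$. A polygonal motion in $\mathcal{P}^*$ is a family $\Gamma(t)\in\mathcal{P}^*$, $t\in\mathcal{I}$; it is of $C^1$-class if all vertices satisfy $\boldsymbol{w}_j\in C^1(\mathcal{I};\mathbb{R}^2)$ (equivalently all heights $h_j(t)$ are $C^1$). The outward normal velocity at $(1-\theta)\boldsymbol{w}_{j-1}(t)+\theta\boldsymbol{w}_j(t)\in\Gamma_j(t)$ is $V_j=(1-\theta)\dot{\boldsymbol{w}}_{j-1}(t)\cdot\boldsymbol{n}_j+\theta\dot{\boldsymbol{w}}_j(t)\cdot\boldsymbol{n}_j$; for a polygonal motion in $\mathcal{P}^*$ it is constant on each edge and $V_j(t)=\dot h_j(t)$. The normal velocity of $\Gamma(t)$ is $V=\sum_{j=1}^N V_j\chi_j\in L^\infty(\Gamma(t))$;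 $ds$ is arc length. *)

theory Defs
  imports "HOL-Complex_Analysis.Complex_Analysis"
begin

text \<open>
  The Euclidean plane is the type \<^typ>\<open>complex\<close>, with inner product \<open>\<bullet>\<close>. A numbered polygon is given
  by its vertices \<open>w :: int \<Rightarrow> complex\<close>, periodic with period \<open>N\<close>.
\<close>

text \<open>The piecewise linear path through \<open>w 0, w 1, \<dots>, w (n + 1)\<close>.\<close>

primrec vertex_path :: "(int \<Rightarrow> complex) \<Rightarrow> nat \<Rightarrow> real \<Rightarrow> complex" where
  "vertex_path w 0 = linepath (w 0) (w 1)"
| "vertex_path w (Suc n) = vertex_path w n +++ linepath (w (int n + 1)) (w (int n + 2))"

definition polygon_path :: "nat \<Rightarrow> (int \<Rightarrow> complex) \<Rightarrow> real \<Rightarrow> complex" where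
  "polygon_path N w = vertex_path w (N - 1)"

definition curve :: "nat \<Rightarrow> (int \<Rightarrow> complex) \<Rightarrow> complex set" where
  "curve N w = path_image (polygon_path N w)"

text \<open>
  \<open>N\<close>-polygons numbered counterclockwise. Non-collinearity says that every \<open>w j\<close> is a genuine
  vertex, i.e. that no outer angle is \<open>0\<close>.
\<close>

definition polygon :: "nat \<Rightarrow> (int \<Rightarrow> complex) \<Rightarrow> bool" where
  "polygon N w \<longleftrightarrow>
     N \<ge> 3 \<and> (\<forall>j. w (j + int N) = w j) \<and>
     (\<forall>j. \<not> collinear {w (j - 1), w j, w (j + 1)}) \<and>
     simple_path (polygon_path N w) \<and>
     (\<forall>z \<in> inside (curve N w). winding_number (polygon_path N w) z = 1)"

definition edge :: "(int \<Rightarrow> complex) \<Rightarrow> int \<Rightarrow> complex set" where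
  "edge w j = {(1 - \<theta>) *\<^sub>R w (j - 1) + \<theta> *\<^sub>R w j |\<theta>. 0 < \<theta> \<and> \<theta> < 1}"

definition edge_length :: "(int \<Rightarrow> complex) \<Rightarrow> int \<Rightarrow> real" where
  "edge_length w j = dist (w (j - 1)) (w j)"

definition perimeter :: "nat \<Rightarrow> (int \<Rightarrow> complex) \<Rightarrow> real" where
  "perimeter N w = (\<Sum>j = 1..int N. edge_length w j)"

definition tangent :: "(int \<Rightarrow> complex) \<Rightarrow> int \<Rightarrow> complex" where
  "tangent w j = (w j - w (j - 1)) /\<^sub>R edge_length w j"

definition outward_normal :: "nat \<Rightarrow> (int \<Rightarrow> complex) \<Rightarrow> int \<Rightarrow> complex" where
  "outward_normal N w j =
     (THE n. norm n = 1 \<and> n \<bullet> tangent w j = 0 \<and>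
        (\<forall>x \<in> edge w j. \<forall>\<^sub>F \<epsilon> in at_right 0. x + \<epsilon> *\<^sub>R n \<in> outside (curve N w)))"

definition outer_angle :: "nat \<Rightarrow> (int \<Rightarrow> complex) \<Rightarrow> int \<Rightarrow> real" where
  "outer_angle N w j =
     (THE \<phi>. \<phi> \<in> {-pi<..<pi} - {0} \<and>
        outward_normal N w (j + 1) \<bullet> outward_normal N w j = cos \<phi> \<and>
        outward_normal N w (j + 1) \<bullet> tangent w j = sin \<phi>)"

definition edge_curvature :: "nat \<Rightarrow> (int \<Rightarrow> complex) \<Rightarrow> int \<Rightarrow> real" where
  "edge_curvature N w j =
     (tan (outer_angle N w j / 2) + tan (outer_angle N w (j - 1) / 2)) / edge_length w j"

definition curvature :: "nat \<Rightarrow> (int \<Rightarrow> complex) \<Rightarrow> complex \<Rightarrow> real" where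
  "curvature N w x = (\<Sum>j = 1..int N. edge_curvature N w j * indicator (edge w j) x)"

text \<open>
  The equivalence class of \<open>w\<^sub>0\<close>, its elements carrying the numbering for which the normals
  coincide with those of \<open>w\<^sub>0\<close>.
\<close>

definition polygon_class :: "nat \<Rightarrow> (int \<Rightarrow> complex) \<Rightarrow> (int \<Rightarrow> complex) set" where
  "polygon_class N w\<^sub>0 =
     {w. polygon N w \<and> (\<forall>j. outward_normal N w j = outward_normal N w\<^sub>0 j)}"

text \<open>
  A family of polygons is \<open>w :: real \<Rightarrow> int \<Rightarrow> complex\<close>, with \<open>w t j\<close> the \<open>j\<close>-th vertex at time \<open>t\<close>.
  Time derivatives are taken within the time interval, so they are one-sided at its endpoints.
\<close>

definition C1_motion ::
    "nat \<Rightarrow> (int \<Rightarrow> complex) \<Rightarrow> real set \<Rightarrow> (real \<Rightarrow> int \<Rightarrow> complex) \<Rightarrow> bool" where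
  "C1_motion N w\<^sub>0 I w \<longleftrightarrow>
     (\<forall>t\<in>I. w t \<in> polygon_class N w\<^sub>0) \<and>
     (\<forall>j. \<exists>D. (\<forall>t\<in>I. ((\<lambda>s. w s j) has_vector_derivative D t) (at t within I)) \<and>
              continuous_on I D)"

definition vertex_velocity ::
    "real set \<Rightarrow> (real \<Rightarrow> int \<Rightarrow> complex) \<Rightarrow> real \<Rightarrow> int \<Rightarrow> complex" where
  "vertex_velocity I w t j = vector_derivative (\<lambda>s. w s j) (at t within I)"

text \<open>The outward normal velocity at the point \<open>(1 - \<theta>) w\<^sub>j\<^sub>-\<^sub>1(t) + \<theta> w\<^sub>j(t)\<close>.\<close>

definition point_velocity ::
    "nat \<Rightarrow> real set \<Rightarrow> (real \<Rightarrow> int \<Rightarrow> complex) \<Rightarrow> real \<Rightarrow> int \<Rightarrow> real \<Rightarrow> real" where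
  "point_velocity N I w t j \<theta> =
     (1 - \<theta>) * (vertex_velocity I w t (j - 1) \<bullet> outward_normal N (w t) j) +
     \<theta> * (vertex_velocity I w t j \<bullet> outward_normal N (w t) j)"

text \<open>The constant value of the normal velocity on the \<open>j\<close>-th edge of a motion in a class.\<close>

definition edge_velocity ::
    "nat \<Rightarrow> real set \<Rightarrow> (real \<Rightarrow> int \<Rightarrow> complex) \<Rightarrow> real \<Rightarrow> int \<Rightarrow> real" where
  "edge_velocity N I w t j = (THE v. \<forall>\<theta>. 0 < \<theta> \<and> \<theta> < 1 \<longrightarrow> point_velocity N I w t j \<theta> = v)"

definition normal_velocity ::
    "nat \<Rightarrow> real set \<Rightarrow> (real \<Rightarrow> int \<Rightarrow> complex) \<Rightarrow> real \<Rightarrow> complex \<Rightarrow> real" where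
  "normal_velocity N I w t x =
     (\<Sum>j = 1..int N. edge_velocity N I w t j * indicator (edge (w t) j) x)"

text \<open>
  The line integral with respect to arc length, along a piecewise \<open>C\<^sup>1\<close> path; the finitely many
  corners do not affect it.
\<close>

definition has_arclength_integral ::
    "(complex \<Rightarrow> real) \<Rightarrow> real \<Rightarrow> (real \<Rightarrow> complex) \<Rightarrow> bool"
    (infixr \<open>has'_arclength'_integral\<close> 50) where
  "(f has_arclength_integral i) \<gamma> \<longleftrightarrow>
     ((\<lambda>s. f (\<gamma> s) * norm (vector_derivative \<gamma> (at s within {0..1}))) has_integral i) {0..1}"

end

theory Submission imports Defs begin

text \<open>
  Write \<open>T\<^sub>j\<close>, \<open>n\<^sub>j\<close> and \<open>v\<^sub>j\<close> for the tangent of the \<open>j\<close>-th edge, its outward normal and the velocity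
  of the \<open>j\<close>-th vertex. In an equivalence class the \<open>n\<^sub>j\<close>, hence the \<open>T\<^sub>j\<close>, do not depend on time, so
  the length \<open>L\<^sub>j = (w\<^sub>j - w\<^sub>j\<^sub>-\<^sub>1) \<bullet> T\<^sub>j\<close> has derivative \<open>(v\<^sub>j - v\<^sub>j\<^sub>-\<^sub>1) \<bullet> T\<^sub>j\<close>, while
  \<open>(w\<^sub>j - w\<^sub>j\<^sub>-\<^sub>1) \<bullet> n\<^sub>j = 0\<close> gives \<open>v\<^sub>j\<^sub>-\<^sub>1 \<bullet> n\<^sub>j = v\<^sub>j \<bullet> n\<^sub>j = V\<^sub>j\<close>. Summing by parts over the closed
  polygon, the perimeter has derivative \<open>\<Sum>\<^sub>j v\<^sub>j \<bullet> (T\<^sub>j - T\<^sub>j\<^sub>+\<^sub>1)\<close>. The geometric identity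
  \<open>T\<^sub>j - T\<^sub>j\<^sub>+\<^sub>1 = tan (\<phi>\<^sub>j / 2) (n\<^sub>j + n\<^sub>j\<^sub>+\<^sub>1)\<close> (\<open>tan_half_angle_normals\<close>) turns this into
  \<open>\<Sum>\<^sub>j tan (\<phi>\<^sub>j / 2) (V\<^sub>j + V\<^sub>j\<^sub>+\<^sub>1)\<close>, and a second shift of the index collects the coefficient of
  \<open>V\<^sub>j\<close>, which is the edge length times the polygonal curvature.

  The topological content is that the outward normal, which is defined through the outside of the
  curve, is the tangent turned clockwise by a right angle (\<open>outward_normal_eq\<close>). This rests on
  the jump of the winding number: crossing an edge from left to right lowers it by one
  (\<open>winding_number_linepath_jump\<close>). Since a counterclockwise polygon has winding number \<open>1\<close> inside
  and \<open>0\<close> outside, the left side of every edge is inside and the right side is outside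
  (\<open>polygon_sides\<close>).

  For the integral form, curvature and normal velocity are constant on each open edge because distinct
  edges are disjoint (\<open>polygon_edge_disjoint\<close>), and arc length integrals add up along joined
  paths (\<open>has_arclength_integral_join\<close>).
\<close>

section \<open>Vertex paths and their edges\<close>

lemma pathstart_vertex_path [simp]: "pathstart (vertex_path w n) = w 0"
  by (induction n) auto

lemma pathfinish_vertex_path [simp]: "pathfinish (vertex_path w n) = w (int n + 1)"
  by (cases n) (auto simp: algebra_simps)

lemma valid_path_vertex_path [simp]: "valid_path (vertex_path w n)"
  by (induction n) (auto intro!: valid_path_join)

lemma path_vertex_path [simp]: "path (vertex_path w n)"
  by (simp add: valid_path_imp_path)

lemma last_edge_split: "{1..int (Suc n) + 1} = insert (int n + 2) {1..int n + 1}"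
  by auto

lemma path_image_vertex_path:
  "path_image (vertex_path w n) = (\<Union>j\<in>{1..int n + 1}. closed_segment (w (j - 1)) (w j))"
proof (induction n)
  case (Suc n)
  then show ?case
    unfolding last_edge_split
    by (simp add: path_image_join algebra_simps Un_commute)
qed simp

lemma winding_number_vertex_path:
  assumes "z \<notin> path_image (vertex_path w n)"
  shows "winding_number (vertex_path w n) z
       = (\<Sum>j = 1..int n + 1. winding_number (linepath (w (j - 1)) (w j)) z)"
  using assms
proof (induction n)
  case (Suc n)
  then have "z \<notin> path_image (vertex_path w n)"
    and "z \<notin> closed_segment (w (int n + 1)) (w (int n + 2))"
    by (simp_all add: path_image_join)
  with Suc.IH show ?case
    unfolding last_edge_split by (simp add: winding_number_join add_ac)
qed simp

lemma edge_eq_open_segment: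
  assumes "w (j - 1) \<noteq> w j"
  shows "edge w j = open_segment (w (j - 1)) (w j)"
  using assms by (auto simp: edge_def in_segment)

lemma edge_subset_closed_segment: "edge w j \<subseteq> closed_segment (w (j - 1)) (w j)"
proof
  fix x assume "x \<in> edge w j"
  then obtain \<theta> where "0 < \<theta>" "\<theta> < 1" "x = (1 - \<theta>) *\<^sub>R w (j - 1) + \<theta> *\<^sub>R w j"
    by (auto simp: edge_def)
  then show "x \<in> closed_segment (w (j - 1)) (w j)"
    unfolding in_segment by (intro exI[of _ \<theta>]) simp
qed

text \<open>
  By induction along the path: a new segment meets the earlier ones only in its initial vertex, and
  that vertex lies on the previous segment, hence on none of the earlier open edges.
\<close>

lemma edge_disjoint_if_arc:
  assumes "\<And>j. w (j - 1) \<noteq> w j" and "arc (vertex_path w n)"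
    and "j \<in> {1..int n + 1}" "k \<in> {1..int n + 1}" "j \<noteq> k"
  shows "edge w j \<inter> closed_segment (w (k - 1)) (w k) = {}"
  using assms(2-)
proof (induction n arbitrary: j k)
  case (Suc n)
  let ?last = "closed_segment (w (int n + 1)) (w (int n + 2))"
  have arc: "arc (vertex_path w n)"
    and meet: "path_image (vertex_path w n) \<inter> ?last \<subseteq> {w (int n + 1)}"
    using Suc.prems(1) by (auto simp: arc_join_eq)
  note IH = Suc.IH[OF arc]
  have no_end: "w (j - 1) \<notin> edge w j" "w j \<notin> edge w j" for j
    using edge_eq_open_segment[where w = w, OF assms(1)] by (auto simp: open_segment_def)
  have in_image: "closed_segment (w (j - 1)) (w j) \<subseteq> path_image (vertex_path w n)"
    if "j \<in> {1..int n + 1}" for j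
    using that by (auto simp: path_image_vertex_path)
  show ?case
  proof (rule ccontr)
    assume "edge w j \<inter> closed_segment (w (k - 1)) (w k) \<noteq> {}"
    then obtain x where xj: "x \<in> edge w j" and xk: "x \<in> closed_segment (w (k - 1)) (w k)"
      by blast
    have xj': "x \<in> closed_segment (w (j - 1)) (w j)"
      using xj edge_subset_closed_segment by blast
    consider "j \<in> {1..int n + 1}" "k \<in> {1..int n + 1}"
      | "j = int n + 2" "k \<in> {1..int n + 1}" | "j \<in> {1..int n + 1}" "k = int n + 2"
      using Suc.prems(2-) by force
    then show False
    proof cases
      case 1
      then show False using IH Suc.prems(4) xj xk by blast
    next
      case 2
      have "x = w (int n + 1)"
        using meet in_image[OF 2(2)] xk xj' 2(1) by (auto simp: algebra_simps)
      then show False using no_end(1)[of "int n + 2"] xj 2(1) by (auto simp: algebra_simps)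
    next
      case 3
      have x: "x = w (int n + 1)"
        using meet in_image[OF 3(1)] xk xj' 3(2) by (auto simp: algebra_simps)
      show False
      proof (cases "j = int n + 1")
        case True
        then show False using x no_end(2)[of j] xj by simp
      next
        case False
        then have "edge w j \<inter> closed_segment (w (int n + 1 - 1)) (w (int n + 1)) = {}"
          using IH[of j "int n + 1"] 3 by auto
        then show False using x xj by auto
      qed
    qed
  qed
qed auto

lemma polygon_periodic: "polygon N w \<Longrightarrow> w (j + int N) = w j"
  by (simp add: polygon_def)

lemma polygon_vertices_distinct:
  assumes "polygon N w"
  shows "w (j - 1) \<noteq> w j"
proof
  assume "w (j - 1) = w j"
  then have "collinear {w (j - 1), w j, w (j + 1)}"
    by (simp add: collinear_2)
  then show False
    using assms by (simp add: polygon_def)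
qed

lemma polygon_closed:
  assumes "polygon N w"
  shows "pathfinish (polygon_path N w) = pathstart (polygon_path N w)"
  using assms polygon_periodic[OF assms, of 0]
  by (simp add: polygon_path_def polygon_def of_nat_diff)

lemma polygon_edges:
  assumes "polygon N w"
  shows "{1..int (N - 1) + 1} = {1..int N}"
  using assms by (auto simp: polygon_def)

text \<open>
  Without its last segment the polygon is an arc. The last segment meets this arc only in the
  vertices \<open>w 0\<close> and \<open>w (N - 1)\<close>, and no vertex lies on an open edge.
\<close>

lemma polygon_edge_disjoint:
  assumes poly: "polygon N w"
    and jk: "j \<in> {1..int N}" "k \<in> {1..int N}" "j \<noteq> k"
  shows "edge w j \<inter> closed_segment (w (k - 1)) (w k) = {}"
proof -
  define m where "m = N - 2"
  have N: "int N = int m + 2" "N - 1 = Suc m"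
    using poly by (auto simp: polygon_def m_def)
  note ne = polygon_vertices_distinct[OF poly]
  have closed: "w (int m + 2) = w 0"
    using polygon_periodic[OF poly, of 0] N by simp
  let ?last = "closed_segment (w (int m + 1)) (w (int m + 2))"
  have "simple_path (vertex_path w (Suc m))"
    using poly N by (simp add: polygon_def polygon_path_def)
  then have arc: "arc (vertex_path w m)"
    and meet: "path_image (vertex_path w m) \<inter> ?last \<subseteq> {w 0, w (int m + 1)}"
    by (auto simp: simple_path_join_loop_eq closed)
  note disj = edge_disjoint_if_arc[where w = w, OF ne arc]
  have no_end: "w (j - 1) \<notin> edge w j" "w j \<notin> edge w j" for j
    using edge_eq_open_segment[where w = w, OF ne] by (auto simp: open_segment_def)
  have in_image: "closed_segment (w (j - 1)) (w j) \<subseteq> path_image (vertex_path w m)"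
    if "j \<in> {1..int m + 1}" for j
    using that by (auto simp: path_image_vertex_path)
  show ?thesis
  proof (rule ccontr)
    assume "edge w j \<inter> closed_segment (w (k - 1)) (w k) \<noteq> {}"
    then obtain x where xj: "x \<in> edge w j" and xk: "x \<in> closed_segment (w (k - 1)) (w k)"
      by blast
    have xj': "x \<in> closed_segment (w (j - 1)) (w j)"
      using xj edge_subset_closed_segment by blast
    consider "j \<in> {1..int m + 1}" "k \<in> {1..int m + 1}"
      | "j = int m + 2" "k \<in> {1..int m + 1}" | "j \<in> {1..int m + 1}" "k = int m + 2"
      using jk N by force
    then show False
    proof cases
      case 1
      then show False using disj jk(3) xj xk by blast
    next
      case 2
      have "x \<in> {w 0, w (int m + 1)}"
        using meet in_image[OF 2(2)] xk xj' 2(1) by (auto simp: algebra_simps)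
      then show False
        using no_end[of "int m + 2"] xj 2(1) closed by (auto simp: algebra_simps)
    next
      case 3
      have "x \<in> {w 0, w (int m + 1)}"
        using meet in_image[OF 3(1)] xk xj' 3(2) by (auto simp: algebra_simps)
      moreover have "x \<noteq> w 0"
      proof (cases "j = 1")
        case True
        then show ?thesis using no_end(1)[of 1] xj by auto
      next
        case False
        then show ?thesis using disj[of j 1] 3 xj by auto
      qed
      moreover have "x \<noteq> w (int m + 1)"
      proof (cases "j = int m + 1")
        case True
        then show ?thesis using no_end(2)[of j] xj by auto
      next
        case False
        then show ?thesis using disj[of j "int m + 1"] 3 xj by auto
      qed
      ultimately show False by blast
    qed
  qed
qed

section \<open>The outward normal\<close>

text \<open>
  As \<open>x\<close> runs along the segment, \<open>(x - z) / (a - z)\<close> runs along a segment that starts at \<open>1\<close> and leaves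
  the real axis, so it avoids the slit of the principal logarithm, and \<open>Ln ((x - z) / (a - z))\<close> is a
  primitive of \<open>1 / (x - z)\<close>.
\<close>

lemma winding_number_linepath_Ln:
  assumes "Im ((b - z) / (a - z)) \<noteq> 0"
  shows "winding_number (linepath a b) z = Ln ((b - z) / (a - z)) / (2 * pi * \<i>)"
proof -
  have az: "a \<noteq> z"
    using assms by auto
  have eq: "(x - z) / (a - z) = 1 + of_real s * ((b - z) / (a - z) - 1)"
    if "x = (1 - s) *\<^sub>R a + s *\<^sub>R b" for x s
    using az that by (simp add: field_simps scaleR_conv_of_real)
  have slit: "(x - z) / (a - z) \<notin> \<real>\<^sub>\<le>\<^sub>0" if "x \<in> closed_segment a b" for x
  proof
    assume neg: "(x - z) / (a - z) \<in> \<real>\<^sub>\<le>\<^sub>0"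
    from that obtain s where x: "x = (1 - s) *\<^sub>R a + s *\<^sub>R b"
      by (auto simp: in_segment)
    from neg have "s * Im ((b - z) / (a - z)) = 0" and "Re ((x - z) / (a - z)) \<le> 0"
      unfolding eq[OF x] complex_nonpos_Reals_iff by (simp_all del: Im_divide Re_divide)
    then show False
      using assms unfolding eq[OF x] by (auto simp del: Im_divide Re_divide)
  qed
  have "z \<notin> closed_segment a b"
    using slit[of z] by auto
  moreover have "((\<lambda>x. 1 / (x - z)) has_contour_integral
      (Ln ((pathfinish (linepath a b) - z) / (a - z)) - Ln ((pathstart (linepath a b) - z) / (a - z))))
      (linepath a b)"
  proof (rule contour_integral_primitive[where S = "closed_segment a b"])
    fix x assume x: "x \<in> closed_segment a b"
    then have "x \<noteq> z" using \<open>z \<notin> closed_segment a b\<close> by auto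
    then show "((\<lambda>x. Ln ((x - z) / (a - z))) has_field_derivative 1 / (x - z))
        (at x within closed_segment a b)"
      using slit[OF x] az by (auto intro!: derivative_eq_intros)
  qed auto
  ultimately show ?thesis
    using az by (simp add: winding_number_valid_path contour_integral_unique)
qed

text \<open>
  Seen from a point just to the left of the segment, the segment subtends an angle close to \<open>\<pi>\<close>; seen
  from the mirror point on the right, the angle is close to \<open>- \<pi>\<close>.
\<close>

lemma winding_number_linepath_jump:
  fixes a b x d :: complex and A B :: real
  assumes "A > 0" "B > 0" and d: "d \<noteq> 0" and a: "a = x - A *\<^sub>R d" and b: "b = x + B *\<^sub>R d"
  shows "((\<lambda>\<epsilon>. winding_number (linepath a b) (x + \<epsilon> *\<^sub>R (\<i> * d))
             - winding_number (linepath a b) (x - \<epsilon> *\<^sub>R (\<i> * d))) \<longlongrightarrow> 1) (at_right 0)"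
proof -
  \<comment> \<open>The quotients \<open>(b - z) / (a - z)\<close> for the two points are \<open>- q \<epsilon>\<close> and its conjugate. They lie near
    the slit of \<open>Ln\<close>, on opposite sides, but \<open>q \<epsilon>\<close> tends to the positive real \<open>B / A\<close>, where \<open>Ln\<close> is
    continuous.\<close>
  define q where "q \<epsilon> = (of_real B - \<i> * of_real \<epsilon>) / (of_real A + \<i> * of_real \<epsilon>)" for \<epsilon> :: real
  have left: "(b - (x + \<epsilon> *\<^sub>R (\<i> * d))) / (a - (x + \<epsilon> *\<^sub>R (\<i> * d))) = - q \<epsilon>" for \<epsilon>
  proof -
    have "b - (x + \<epsilon> *\<^sub>R (\<i> * d)) = d * (of_real B - \<i> * of_real \<epsilon>)"
      and "a - (x + \<epsilon> *\<^sub>R (\<i> * d)) = d * (- (of_real A + \<i> * of_real \<epsilon>))"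
      by (simp_all add: a b scaleR_conv_of_real algebra_simps)
    then show ?thesis
      unfolding q_def by (simp only: mult_divide_mult_cancel_left[OF d] minus_divide_right)
  qed
  have right: "(b - (x - \<epsilon> *\<^sub>R (\<i> * d))) / (a - (x - \<epsilon> *\<^sub>R (\<i> * d))) = - cnj (q \<epsilon>)" for \<epsilon>
  proof -
    have "b - (x - \<epsilon> *\<^sub>R (\<i> * d)) = d * (of_real B + \<i> * of_real \<epsilon>)"
      and "a - (x - \<epsilon> *\<^sub>R (\<i> * d)) = d * (- (of_real A - \<i> * of_real \<epsilon>))"
      by (simp_all add: a b scaleR_conv_of_real algebra_simps)
    moreover have "cnj (q \<epsilon>) = (of_real B + \<i> * of_real \<epsilon>) / (of_real A - \<i> * of_real \<epsilon>)"
      by (simp add: q_def)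
    ultimately show ?thesis
      by (simp only: mult_divide_mult_cancel_left[OF d] minus_divide_right)
  qed
  have im: "Im (q \<epsilon>) < 0" if "\<epsilon> > 0" for \<epsilon>
  proof -
    have "Im (q \<epsilon>) = - (\<epsilon> * (A + B)) / (A\<^sup>2 + \<epsilon>\<^sup>2)"
      by (simp add: q_def Im_divide algebra_simps)
    also have "\<dots> < 0"
      using that assms(1,2) by (intro divide_neg_pos) (auto intro: add_pos_pos)
    finally show ?thesis .
  qed
  have diff: "winding_number (linepath a b) (x + \<epsilon> *\<^sub>R (\<i> * d))
            - winding_number (linepath a b) (x - \<epsilon> *\<^sub>R (\<i> * d)) = of_real (Im (Ln (q \<epsilon>)) / pi + 1)"
    if "\<epsilon> > 0" for \<epsilon>
  proof -
    have "q \<epsilon> \<noteq> 0" and ns: "q \<epsilon> \<notin> \<real>\<^sub>\<le>\<^sub>0"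
      using im[OF that] by (auto simp: complex_nonpos_Reals_iff)
    have l: "Ln (- q \<epsilon>) = Ln (q \<epsilon>) + \<i> * pi"
      using Ln_minus[OF \<open>q \<epsilon> \<noteq> 0\<close>] im[OF that] by auto
    have r: "Ln (- cnj (q \<epsilon>)) = cnj (Ln (q \<epsilon>)) - \<i> * pi"
      using Ln_minus[of "cnj (q \<epsilon>)"] \<open>q \<epsilon> \<noteq> 0\<close> im[OF that] cnj_Ln[OF ns] by auto
    have "winding_number (linepath a b) (x + \<epsilon> *\<^sub>R (\<i> * d))
            - winding_number (linepath a b) (x - \<epsilon> *\<^sub>R (\<i> * d))
        = (Ln (- q \<epsilon>) - Ln (- cnj (q \<epsilon>))) / (2 * pi * \<i>)"
      using im[OF that] winding_number_linepath_Ln[of b "x + \<epsilon> *\<^sub>R (\<i> * d)" a]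
        winding_number_linepath_Ln[of b "x - \<epsilon> *\<^sub>R (\<i> * d)" a]
      unfolding left right by (simp add: diff_divide_distrib)
    also have "Ln (- q \<epsilon>) - Ln (- cnj (q \<epsilon>)) = (Ln (q \<epsilon>) - cnj (Ln (q \<epsilon>))) + 2 * \<i> * pi"
      unfolding l r by simp
    also have "\<dots> / (2 * pi * \<i>) = of_real (Im (Ln (q \<epsilon>)) / pi + 1)"
      unfolding complex_diff_cnj by (simp add: field_simps)
    finally show ?thesis .
  qed
  have q0: "q 0 = of_real (B / A)"
    by (simp add: q_def)
  have "B / A > 0" using assms by simp
  have "(q \<longlongrightarrow> q 0) (at_right 0)"
    unfolding q_def using assms by (auto intro!: tendsto_eq_intros)
  then have "((\<lambda>\<epsilon>. Im (Ln (q \<epsilon>))) \<longlongrightarrow> Im (Ln (q 0))) (at_right 0)"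
    using \<open>B / A > 0\<close> unfolding q0
    by (intro tendsto_Im tendsto_Ln) (auto simp: complex_nonpos_Reals_iff simp del: of_real_divide)
  moreover have "Im (Ln (q 0)) = 0"
    using \<open>B / A > 0\<close> unfolding q0 by (simp add: Ln_of_real del: of_real_divide)
  ultimately have "((\<lambda>\<epsilon>. Im (Ln (q \<epsilon>)) / pi + 1) \<longlongrightarrow> 0 / pi + 1) (at_right 0)"
    by (intro tendsto_intros) auto
  from tendsto_of_real[OF this, where ?'a = complex]
  have "((\<lambda>\<epsilon>. of_real (Im (Ln (q \<epsilon>)) / pi + 1) :: complex) \<longlongrightarrow> 1) (at_right 0)"
    by simp
  then show ?thesis
  proof (rule Lim_transform_eventually)
    show "\<forall>\<^sub>F \<epsilon> in at_right 0. of_real (Im (Ln (q \<epsilon>)) / pi + 1)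
        = winding_number (linepath a b) (x + \<epsilon> *\<^sub>R (\<i> * d))
          - winding_number (linepath a b) (x - \<epsilon> *\<^sub>R (\<i> * d))"
      using diff by (intro eventually_at_right_less[THEN eventually_mono]) simp
  qed
qed

lemma norm_tangent:
  assumes "w (j - 1) \<noteq> w j"
  shows "norm (tangent w j) = 1"
  using assms by (simp add: tangent_def edge_length_def dist_norm norm_minus_commute)

lemma edge_vector: "w j - w (j - 1) = edge_length w j *\<^sub>R tangent w j"
  by (cases "w j = w (j - 1)") (auto simp: tangent_def edge_length_def)

lemma closed_segment_off_line:
  fixes x d :: complex
  assumes "d \<noteq> 0" "\<epsilon> \<noteq> 0"
  shows "x + \<epsilon> *\<^sub>R (\<i> * d) \<notin> closed_segment (x - A *\<^sub>R d) (x + B *\<^sub>R d)"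
proof
  assume "x + \<epsilon> *\<^sub>R (\<i> * d) \<in> closed_segment (x - A *\<^sub>R d) (x + B *\<^sub>R d)"
  then obtain s where "x + \<epsilon> *\<^sub>R (\<i> * d) = (1 - s) *\<^sub>R (x - A *\<^sub>R d) + s *\<^sub>R (x + B *\<^sub>R d)"
    by (auto simp: in_segment)
  then have "d * (\<i> * of_real \<epsilon>) = d * of_real (s * B - (1 - s) * A)"
    by (simp add: scaleR_conv_of_real algebra_simps)
  then have "\<i> * of_real \<epsilon> = (of_real (s * B - (1 - s) * A) :: complex)"
    using assms by simp
  from arg_cong[OF this, of Im] show False
    using assms by simp
qed

text \<open>
  Near \<open>x\<close> the contributions of the other edges to the winding number are continuous, so the difference of the
  winding numbers at the two points tends to \<open>1\<close>. Both numbers are \<open>0\<close> or \<open>1\<close>, so eventually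
  they are \<open>1\<close> on the left and \<open>0\<close> on the right.
\<close>

lemma polygon_sides:
  assumes poly: "polygon N w" and j: "j \<in> {1..int N}" and x: "x \<in> edge w j"
  shows "\<forall>\<^sub>F \<epsilon> in at_right 0. x + \<epsilon> *\<^sub>R (\<i> * tangent w j) \<in> inside (curve N w) \<and>
                              x - \<epsilon> *\<^sub>R (\<i> * tangent w j) \<in> outside (curve N w)"
proof -
  define T where "T = tangent w j"
  define u where "u = \<i> * T"
  define p where "p = polygon_path N w"
  let ?seg = "\<lambda>k. closed_segment (w (k - 1)) (w k)"
  let ?wn = "\<lambda>k. winding_number (linepath (w (k - 1)) (w k))"
  note ne = polygon_vertices_distinct[OF poly]
  have image: "path_image p = (\<Union>k\<in>{1..int N}. ?seg k)"
    unfolding p_def polygon_path_def path_image_vertex_path polygon_edges[OF poly] ..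
  have path: "path p" "pathfinish p = pathstart p"
    using polygon_closed[OF poly] by (simp_all add: p_def polygon_path_def)
  have T: "T \<noteq> 0"
    using norm_tangent[of w j] ne[of j] by (auto simp: T_def)
  obtain \<theta> where \<theta>: "0 < \<theta>" "\<theta> < 1" and xeq: "x = (1 - \<theta>) *\<^sub>R w (j - 1) + \<theta> *\<^sub>R w j"
    using x by (auto simp: edge_def)
  define A B where "A = \<theta> * edge_length w j" and "B = (1 - \<theta>) * edge_length w j"
  have AB: "A > 0" "B > 0"
    using \<theta> ne[of j] by (auto simp: A_def B_def edge_length_def)
  have wj: "w (j - 1) = x - A *\<^sub>R T" "w j = x + B *\<^sub>R T"
  proof -
    have L: "edge_length w j *\<^sub>R T = w j - w (j - 1)"
      by (simp add: T_def edge_vector)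
    show "w (j - 1) = x - A *\<^sub>R T"
      unfolding A_def scaleR_scaleR[symmetric] L xeq by (simp add: algebra_simps)
    show "w j = x + B *\<^sub>R T"
      unfolding B_def scaleR_scaleR[symmetric] L xeq by (simp add: algebra_simps)
  qed
  have plus: "((\<lambda>\<epsilon>. x + \<epsilon> *\<^sub>R u) \<longlongrightarrow> x) (at_right 0)"
    and minus: "((\<lambda>\<epsilon>. x - \<epsilon> *\<^sub>R u) \<longlongrightarrow> x) (at_right 0)"
    by (auto intro!: tendsto_eq_intros)
  let ?others = "{1..int N} - {j}"
  have x_off: "x \<notin> ?seg k" if "k \<in> ?others" for k
    using polygon_edge_disjoint[OF poly j, of k] that x by auto
  have off_others: "\<forall>\<^sub>F \<epsilon> in at_right 0. y \<epsilon> \<notin> (\<Union>k\<in>?others. ?seg k)"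
    if "(y \<longlongrightarrow> x) (at_right 0)" for y :: "real \<Rightarrow> complex"
  proof -
    have "open (- (\<Union>k\<in>?others. ?seg k))"
      by (intro open_Compl closed_UN) auto
    from topological_tendstoD[OF that this] x_off show ?thesis
      by auto
  qed
  have off_edge: "x + \<epsilon> *\<^sub>R u \<notin> ?seg j" "x - \<epsilon> *\<^sub>R u \<notin> ?seg j" if "\<epsilon> > 0" for \<epsilon>
    using closed_segment_off_line[OF T, of \<epsilon> x A B] closed_segment_off_line[OF T, of "-\<epsilon>" x A B] that
    by (simp_all add: wj u_def)
  have off: "\<forall>\<^sub>F \<epsilon> in at_right 0. x + \<epsilon> *\<^sub>R u \<notin> path_image p \<and> x - \<epsilon> *\<^sub>R u \<notin> path_image p"
    using off_others[OF plus] off_others[OF minus] eventually_at_right_less[of 0]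
  proof eventually_elim
    case (elim \<epsilon>)
    then show ?case
      using off_edge[of \<epsilon>] by (auto simp: image)
  qed
  have split: "winding_number p z = ?wn j z + (\<Sum>k\<in>?others. ?wn k z)" if "z \<notin> path_image p" for z
    using winding_number_vertex_path[of z w "N - 1"] that j
    by (simp add: p_def polygon_path_def polygon_edges[OF poly] sum.remove)
  have others: "((\<lambda>\<epsilon>. \<Sum>k\<in>?others. ?wn k (y \<epsilon>)) \<longlongrightarrow> (\<Sum>k\<in>?others. ?wn k x)) (at_right 0)"
    if "(y \<longlongrightarrow> x) (at_right 0)" for y :: "real \<Rightarrow> complex"
    by (intro tendsto_sum isCont_tendsto_compose[OF _ that] continuous_at_winding_number)
       (use x_off in auto)
  have "((\<lambda>\<epsilon>. (?wn j (x + \<epsilon> *\<^sub>R u) - ?wn j (x - \<epsilon> *\<^sub>R u)) +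
              ((\<Sum>k\<in>?others. ?wn k (x + \<epsilon> *\<^sub>R u)) - (\<Sum>k\<in>?others. ?wn k (x - \<epsilon> *\<^sub>R u)))) \<longlongrightarrow>
          1 + ((\<Sum>k\<in>?others. ?wn k x) - (\<Sum>k\<in>?others. ?wn k x))) (at_right 0)"
    unfolding u_def
    by (intro tendsto_add tendsto_diff winding_number_linepath_jump[OF AB T wj]
        others[OF plus[unfolded u_def]] others[OF minus[unfolded u_def]])
  then have "((\<lambda>\<epsilon>. winding_number p (x + \<epsilon> *\<^sub>R u) - winding_number p (x - \<epsilon> *\<^sub>R u)) \<longlongrightarrow> 1) (at_right 0)"
    by (rule Lim_transform_eventually[THEN tendsto_eq_rhs])
       (use off in \<open>auto elim!: eventually_mono simp: split\<close>)
  then have near: "\<forall>\<^sub>F \<epsilon> in at_right 0.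
      dist (winding_number p (x + \<epsilon> *\<^sub>R u) - winding_number p (x - \<epsilon> *\<^sub>R u)) 1 < 1"
    by (rule tendstoD) simp
  have inside: "winding_number p z = 1" if "z \<in> inside (path_image p)" for z
    using poly that by (simp add: polygon_def p_def curve_def)
  have outside: "winding_number p z = 0" if "z \<in> outside (path_image p)" for z
    using winding_number_zero_in_outside[OF path that] .
  have sides: "z \<in> inside (path_image p) \<or> z \<in> outside (path_image p)" if "z \<notin> path_image p" for z
    using that inside_Un_outside[of "path_image p"] by blast
  have "\<forall>\<^sub>F \<epsilon> in at_right 0. x + \<epsilon> *\<^sub>R u \<in> inside (path_image p) \<and> x - \<epsilon> *\<^sub>R u \<in> outside (path_image p)"
    using near off
  proof eventually_elim
    case (elim \<epsilon>)
    then show ?case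
      using sides[of "x + \<epsilon> *\<^sub>R u"] sides[of "x - \<epsilon> *\<^sub>R u"]
      by (auto simp: inside outside dist_norm)
  qed
  then show ?thesis
    by (simp add: u_def T_def p_def curve_def)
qed

lemma unit_orthogonal_complex:
  fixes n T :: complex
  assumes "norm n = 1" "norm T = 1" "n \<bullet> T = 0"
  shows "n = \<i> * T \<or> n = - (\<i> * T)"
proof -
  define r where "r = n * cnj T"
  have "T * cnj T = 1"
    using assms(2) by (simp add: complex_norm_square[symmetric])
  then have n: "n = r * T"
    by (simp add: r_def mult.assoc mult.commute[of "cnj T"])
  have "Re r = 0" "norm r = 1"
    using assms by (simp_all add: r_def inner_complex_def norm_mult)
  then have "Im r = 1 \<or> Im r = -1"
    by (auto simp: cmod_def abs_if split: if_splits)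
  then have "r = \<i> \<or> r = - \<i>"
    using \<open>Re r = 0\<close> by (auto simp: complex_eq_iff)
  then show ?thesis
    using n by auto
qed

text \<open>
  Only the two unit vectors orthogonal to the edge can qualify; \<open>polygon_sides\<close> admits the
  clockwise one and, since inside and outside are disjoint, rejects the other.
\<close>

lemma outward_normal_eq:
  assumes poly: "polygon N w"
  shows "outward_normal N w j = - (\<i> * tangent w j)"
proof -
  have period: "w (i + int N * m) = w i" for i m
  proof (induction m rule: int_induct[where k = 0])
    case (step1 m)
    then show ?case
      using polygon_periodic[OF poly, of "i + int N * m"] by (simp add: algebra_simps)
  next
    case (step2 m)
    then show ?case
      using polygon_periodic[OF poly, of "i + int N * (m - 1)"] by (simp add: algebra_simps)
  qed simp
  \<comment> \<open>The representative of \<open>j\<close> modulo \<open>N\<close> in \<open>{1..N}\<close>.\<close>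
  define k where "k = (j - 1) mod int N + 1"
  define m where "m = (j - 1) div int N"
  have "int N > 0"
    using poly by (auto simp: polygon_def)
  then have k: "k \<in> {1..int N}"
    using pos_mod_bound[of "int N" "j - 1"] pos_mod_sign[of "int N" "j - 1"]
    unfolding k_def atLeastAtMost_iff by linarith
  have j: "j = k + int N * m" "j - 1 = k - 1 + int N * m"
    by (simp_all add: k_def m_def)
  have "w j = w k" "w (j - 1) = w (k - 1)"
    unfolding j(2) unfolding j(1) by (rule period)+
  then have same: "edge w j = edge w k" "tangent w j = tangent w k"
    by (simp_all add: edge_def tangent_def edge_length_def)
  define T where "T = tangent w k"
  have T: "norm T = 1"
    using norm_tangent polygon_vertices_distinct[OF poly] by (simp add: T_def)
  note sides = polygon_sides[OF poly k, folded T_def]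
  show ?thesis
    unfolding outward_normal_def same T_def[symmetric]
  proof (rule the_equality, intro conjI ballI)
    show "norm (- (\<i> * T)) = 1" "- (\<i> * T) \<bullet> T = 0"
      using T by (simp_all add: norm_mult inner_complex_def)
    fix x assume "x \<in> edge w k"
    from sides[OF this]
    show "\<forall>\<^sub>F \<epsilon> in at_right 0. x + \<epsilon> *\<^sub>R - (\<i> * T) \<in> outside (curve N w)"
      by (auto elim: eventually_mono)
  next
    fix n assume n: "norm n = 1 \<and> n \<bullet> T = 0 \<and>
        (\<forall>x\<in>edge w k. \<forall>\<^sub>F \<epsilon> in at_right 0. x + \<epsilon> *\<^sub>R n \<in> outside (curve N w))"
    have "(1 - 1/2) *\<^sub>R w (k - 1) + (1/2) *\<^sub>R w k \<in> edge w k"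
      unfolding edge_def by (rule CollectI, rule exI[of _ "1/2"]) simp
    then obtain x where x: "x \<in> edge w k" by blast
    have "n \<noteq> \<i> * T"
    proof
      assume "n = \<i> * T"
      then have "\<forall>\<^sub>F \<epsilon> in at_right 0. x + \<epsilon> *\<^sub>R (\<i> * T) \<in> outside (curve N w)"
        using n x by blast
      with sides[OF x] have "\<forall>\<^sub>F \<epsilon> in at_right (0::real). False"
      proof eventually_elim
        case (elim \<epsilon>)
        then show ?case
          using inside_Int_outside[of "curve N w"] by blast
      qed
      then show False by simp
    qed
    then show "n = - (\<i> * T)"
      using unit_orthogonal_complex[of n T] n T by blast
  qed
qed

section \<open>Outer angles\<close>

text \<open>
  The normals are the tangents turned by the same right angle, so their two inner products are
  the real and the imaginary part of the unit number \<open>T\<^sub>j\<^sub>+\<^sub>1 / T\<^sub>j\<close>. Its argument avoids \<open>0\<close> and \<open>\<pi>\<close>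
  because three consecutive vertices are not collinear.
\<close>

lemma outer_angle_polygon:
  assumes poly: "polygon N w"
  shows "outer_angle N w j = Arg (tangent w (j + 1) * cnj (tangent w j))"
    and "outer_angle N w j \<in> {-pi<..<pi}"
    and "tangent w (j + 1) = cis (outer_angle N w j) * tangent w j"
proof -
  define T T' where "T = tangent w j" and "T' = tangent w (j + 1)"
  define r where "r = T' * cnj T"
  have norms: "norm T = 1" "norm T' = 1"
    using norm_tangent[of w j] norm_tangent[of w "j + 1"] polygon_vertices_distinct[OF poly]
      polygon_vertices_distinct[OF poly, of "j + 1"]
    by (simp_all add: T_def T'_def)
  have TT: "cnj T * T = 1"
    using norms(1) by (simp add: complex_norm_square[symmetric] mult.commute)
  have T': "T' = r * T"
    by (simp add: r_def mult.assoc TT)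
  have nr: "norm r = 1"
    by (simp add: r_def norm_mult norms)
  have Im_r: "Im r \<noteq> 0"
  proof
    assume "Im r = 0"
    then have "r = of_real (Re r)"
      by (simp add: complex_eq_iff)
    then have T'R: "T' = Re r *\<^sub>R T"
      using T' by (simp add: scaleR_conv_of_real)
    let ?L = "edge_length w j" and ?L' = "edge_length w (j + 1)"
    have v1: "w (j - 1) = w j + (- ?L) *\<^sub>R T"
      using edge_vector[of w j] by (simp add: T_def algebra_simps)
    have v2: "w (j + 1) = w j + (?L' * Re r) *\<^sub>R T"
      using edge_vector[of w "j + 1"] T'R by (simp add: T'_def algebra_simps)
    have "collinear {w (j - 1), w j, w (j + 1)}"
      unfolding collinear_alt
      by (rule exI[of _ "w j"], rule exI[of _ T]) (use v1 v2 in \<open>auto intro: exI[of _ 0] exI[of _ "- ?L"]\<close>)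
    then show False
      using poly by (simp add: polygon_def)
  qed
  have angle: "\<phi> \<in> {-pi<..<pi} - {0} \<and>
        outward_normal N w (j + 1) \<bullet> outward_normal N w j = cos \<phi> \<and>
        outward_normal N w (j + 1) \<bullet> tangent w j = sin \<phi> \<longleftrightarrow>
      \<phi> = Arg r" for \<phi>
  proof -
    have cs: "outward_normal N w (j + 1) \<bullet> outward_normal N w j = Re r"
      "outward_normal N w (j + 1) \<bullet> tangent w j = Im r"
      unfolding outward_normal_eq[OF poly] r_def T_def T'_def
      by (simp_all add: inner_complex_def algebra_simps)
    have r: "cis (Arg r) = r"
      using nr by (subst cis_Arg) (auto simp: sgn_eq)
    have "Arg r \<noteq> 0" "Arg r \<noteq> pi"
      using r Im_r by (metis cis_zero one_complex.sel(2), metis Im_r cis.sel(2) sin_pi)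
    moreover have "- pi < Arg r" "Arg r \<le> pi"
      using Arg_bounded by auto
    moreover have "\<phi> = Arg r"
      if "\<phi> \<in> {-pi<..<pi}" "Re r = cos \<phi>" "Im r = sin \<phi>"
    proof -
      have "sgn r = cis \<phi>"
        using that nr by (simp add: sgn_eq complex_eq_iff)
      then show ?thesis
        using cis_Arg_unique[of r \<phi>] that by auto
    qed
    moreover have "Re r = cos (Arg r)" "Im r = sin (Arg r)"
      using r by (metis cis.sel(1), metis r cis.sel(2))
    ultimately show ?thesis
      unfolding cs by auto
  qed
  have eq: "outer_angle N w j = Arg r"
    unfolding outer_angle_def angle by simp
  then show "outer_angle N w j = Arg (tangent w (j + 1) * cnj (tangent w j))"
    by (simp add: r_def T_def T'_def)
  show "outer_angle N w j \<in> {-pi<..<pi}"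
    using angle[of "Arg r"] eq by auto
  have "cis (Arg r) = r"
    using nr by (subst cis_Arg) (auto simp: sgn_eq)
  then show "tangent w (j + 1) = cis (outer_angle N w j) * tangent w j"
    using T' unfolding eq by (simp add: T_def T'_def)
qed

text \<open>
  After division by \<open>T\<^sub>j\<close> and with \<open>h = \<phi>\<^sub>j / 2\<close>, the identity reads
  \<open>- \<i> tan h (1 + cis (2 h)) = 1 - cis (2 h)\<close>, which is the half-angle formula for the tangent.
\<close>

lemma tan_half_angle_normals:
  assumes poly: "polygon N w"
  shows "tan (outer_angle N w j / 2) *\<^sub>R (outward_normal N w j + outward_normal N w (j + 1))
       = tangent w j - tangent w (j + 1)"
proof -
  define h where "h = outer_angle N w j / 2"
  have "cos h > 0"
    using outer_angle_polygon(2)[OF poly, of j] by (intro cos_gt_zero_pi) (auto simp: h_def)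
  have "outer_angle N w j = 2 * h"
    by (simp add: h_def)
  then have T': "tangent w (j + 1) = cis (2 * h) * tangent w j"
    using outer_angle_polygon(3)[OF poly, of j] by simp
  have "cos h * (tan h * sin (2 * h)) = cos h * (1 - cos (2 * h))"
       "cos h * (tan h * (1 + cos (2 * h))) = cos h * sin (2 * h)"
    using \<open>cos h > 0\<close> unfolding cos_double_sin
    by (simp_all add: tan_def sin_double power2_eq_square)
      (simp add: sin_squared_eq flip: power2_eq_square; simp add: algebra_simps power2_eq_square)
  then have "tan h * sin (2 * h) = 1 - cos (2 * h)" "tan h * (1 + cos (2 * h)) = sin (2 * h)"
    using \<open>cos h > 0\<close> by auto
  then have factor: "of_real (tan h) * (- \<i> * (1 + cis (2 * h))) = 1 - cis (2 * h)"
    by (simp add: complex_eq_iff)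
  have "tan h *\<^sub>R (- (\<i> * tangent w j) + - (\<i> * (cis (2 * h) * tangent w j)))
      = of_real (tan h) * (- \<i> * (1 + cis (2 * h))) * tangent w j"
    by (simp add: scaleR_conv_of_real algebra_simps)
  also have "\<dots> = tangent w j - cis (2 * h) * tangent w j"
    unfolding factor by (simp add: algebra_simps)
  finally show ?thesis
    unfolding outward_normal_eq[OF poly] T' h_def[symmetric] .
qed

section \<open>Arc length integrals along vertex paths\<close>

lemma has_arclength_integral_at:
  "(f has_arclength_integral i) \<gamma> \<longleftrightarrow>
     ((\<lambda>s. f (\<gamma> s) * norm (vector_derivative \<gamma> (at s))) has_integral i) {0..1}"
  unfolding has_arclength_integral_def
  by (rule has_integral_spike_finite_eq[of "{0, 1}"]) (auto simp: at_within_Icc_at)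

text \<open>
  The two halves of a joined path are the original paths run at double speed, with \<open>c = 0\<close> and \<open>c = - 1\<close>.
\<close>

lemma has_integral_double_speed:
  fixes h :: "real \<Rightarrow> real"
  assumes "(h has_integral i) {0..1}" and "a = - c / 2" "b = (1 - c) / 2"
  shows "((\<lambda>x. 2 * h (2 * x + c)) has_integral i) {a..b}"
proof -
  have "(\<lambda>x. (1 / 2) *\<^sub>R x + - ((1 / 2) *\<^sub>R c)) ` cbox 0 1 = {a..b}"
    using image_affinity_atLeastAtMost[of "1 / 2" "- ((1 / 2) * c)" 0 1]
    by (simp add: assms(2,3) diff_divide_distrib)
  moreover have "((\<lambda>x. h (2 *\<^sub>R x + c)) has_integral (1 / \<bar>2\<bar> ^ DIM(real)) *\<^sub>R i) ((\<lambda>x. (1 / 2) *\<^sub>R x + - ((1 / 2) *\<^sub>R c)) ` cbox 0 1)"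
    by (rule has_integral_affinity) (use assms(1) in auto)
  ultimately have "((\<lambda>x. h (2 * x + c)) has_integral i / 2) {a..b}"
    by simp
  from has_integral_mult_right[OF this, of 2] show ?thesis
    by simp
qed

lemma norm_vector_derivative_affine:
  fixes g :: "real \<Rightarrow> 'a::real_normed_vector"
  assumes "g differentiable at (2 * z + c)" and "open S" "z \<in> S"
    and "\<And>x. x \<in> S \<Longrightarrow> h x = g (2 * x + c)"
  shows "norm (vector_derivative h (at z)) = 2 * norm (vector_derivative g (at (2 * z + c)))"
proof -
  have "((\<lambda>x. 2 * x + c) has_vector_derivative 2) (at z)"
    by (auto intro!: derivative_eq_intros simp: has_vector_derivative_def)
  from vector_diff_chain_at[OF this, of g] assms(1)
  have "((\<lambda>x. g (2 * x + c)) has_vector_derivative 2 *\<^sub>R vector_derivative g (at (2 * z + c))) (at z)"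
    by (simp add: o_def vector_derivative_works)
  then have "(h has_vector_derivative 2 *\<^sub>R vector_derivative g (at (2 * z + c))) (at z)"
    by (rule has_vector_derivative_transform_within_open[OF _ assms(2,3)]) (simp add: assms(4))
  then show ?thesis
    by (simp add: vector_derivative_at)
qed

text \<open>
  Doubling the speed doubles the norm of the derivative and halves the length of the parameter
  interval. The parameters where one of the paths is not differentiable, and the end points of the two halves,
  form a finite set and do not affect the integral.
\<close>

lemma has_arclength_integral_join:
  assumes int1: "(f has_arclength_integral i1) g1" and int2: "(f has_arclength_integral i2) g2"
    and "valid_path g1" "valid_path g2"
  shows "(f has_arclength_integral (i1 + i2)) (g1 +++ g2)"
proof -
  obtain s1 s2
    where s1: "finite s1" "\<And>x. x \<in> {0..1} - s1 \<Longrightarrow> g1 differentiable at x"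
      and s2: "finite s2" "\<And>x. x \<in> {0..1} - s2 \<Longrightarrow> g2 differentiable at x"
    using assms(3,4) unfolding valid_path_def piecewise_C1_differentiable_on_def C1_differentiable_on_eq
    by blast
  have "((\<lambda>x. 2 * (f (g1 (2 * x + 0)) * norm (vector_derivative g1 (at (2 * x + 0))))) has_integral i1) {0..1/2}"
    by (rule has_integral_double_speed[OF int1[unfolded has_arclength_integral_at], where c = "0"]) simp_all
  then have left: "((\<lambda>x. f ((g1 +++ g2) x) * norm (vector_derivative (g1 +++ g2) (at x))) has_integral i1) {0..1/2}"
  proof (rule has_integral_spike_finite[rotated 2])
    show "finite ({0, 1/2} \<union> (*) 2 -` s1)"
      using s1(1) by (auto intro!: finite_vimageI injI)
    fix x :: real assume "x \<in> {0..1/2} - ({0, 1/2} \<union> (*) 2 -` s1)"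
    then have x: "0 < x" "x < 1/2" "2 * x \<notin> s1" by auto
    then have "norm (vector_derivative (g1 +++ g2) (at x)) = 2 * norm (vector_derivative g1 (at (2 * x)))"
      using norm_vector_derivative_affine[of g1 x 0 "{..<1/2}" "g1 +++ g2"] s1(2)[of "2 * x"]
      by (simp add: joinpaths_def)
    then show "f ((g1 +++ g2) x) * norm (vector_derivative (g1 +++ g2) (at x))
        = 2 * (f (g1 (2 * x + 0)) * norm (vector_derivative g1 (at (2 * x + 0))))"
      using x by (simp add: joinpaths_def)
  qed
  have "((\<lambda>x. 2 * (f (g2 (2 * x + - 1)) * norm (vector_derivative g2 (at (2 * x + - 1))))) has_integral i2) {1/2..1}"
    by (rule has_integral_double_speed[OF int2[unfolded has_arclength_integral_at], where c = "-1"]) simp_all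
  then have right: "((\<lambda>x. f ((g1 +++ g2) x) * norm (vector_derivative (g1 +++ g2) (at x))) has_integral i2) {1/2..1}"
  proof (rule has_integral_spike_finite[rotated 2])
    show "finite ({1/2, 1} \<union> (\<lambda>x. 2 * x - 1) -` s2)"
      using s2(1) by (auto intro!: finite_vimageI injI)
    fix x :: real assume "x \<in> {1/2..1} - ({1/2, 1} \<union> (\<lambda>x. 2 * x - 1) -` s2)"
    then have x: "1/2 < x" "x < 1" "2 * x - 1 \<notin> s2" by auto
    then have "norm (vector_derivative (g1 +++ g2) (at x)) = 2 * norm (vector_derivative g2 (at (2 * x - 1)))"
      using norm_vector_derivative_affine[of g2 x "-1" "{1/2<..}" "g1 +++ g2"] s2(2)[of "2 * x - 1"]
      by (simp add: joinpaths_def)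
    then show "f ((g1 +++ g2) x) * norm (vector_derivative (g1 +++ g2) (at x))
        = 2 * (f (g2 (2 * x + - 1)) * norm (vector_derivative g2 (at (2 * x + - 1))))"
      using x by (simp add: joinpaths_def)
  qed
  show ?thesis
    unfolding has_arclength_integral_at by (rule has_integral_combine[OF _ _ left right]) auto
qed

lemma has_arclength_integral_linepath_const:
  assumes "\<And>x. x \<in> open_segment a b \<Longrightarrow> f x = c"
  shows "(f has_arclength_integral (dist a b * c)) (linepath a b)"
proof (cases "a = b")
  case True
  then show ?thesis
    unfolding has_arclength_integral_at by simp
next
  case False
  have "((\<lambda>s. dist a b * c) has_integral (dist a b * c)) {0..1::real}"
    using has_integral_const_real[of "dist a b * c" 0 1]
    by (simp only: content_real diff_zero scaleR_one zero_le_one)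
  then show ?thesis
    unfolding has_arclength_integral_at
  proof (rule has_integral_spike_finite[rotated 2])
    show "finite {0, 1::real}" by simp
    fix s :: real assume "s \<in> {0..1} - {0, 1}"
    then have "linepath a b s \<in> open_segment a b"
      using False unfolding in_segment linepath_def by (intro conjI exI[of _ s]) auto
    then show "f (linepath a b s) * norm (vector_derivative (linepath a b) (at s)) = dist a b * c"
      by (simp add: assms dist_norm norm_minus_commute)
  qed
qed

lemma has_arclength_integral_vertex_path:
  assumes "\<And>j. w (j - 1) \<noteq> w j"
    and "\<And>j x. j \<in> {1..int n + 1} \<Longrightarrow> x \<in> edge w j \<Longrightarrow> f x = c j"
  shows "(f has_arclength_integral (\<Sum>j = 1..int n + 1. edge_length w j * c j)) (vertex_path w n)"
  using assms(2)
proof (induction n)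
  case 0
  have "(f has_arclength_integral (dist (w 0) (w 1) * c 1)) (linepath (w 0) (w 1))"
    using 0[of 1] edge_eq_open_segment[of w 1] assms(1)[of 1]
    by (intro has_arclength_integral_linepath_const) auto
  then show ?case
    by (simp add: edge_length_def)
next
  case (Suc n)
  let ?a = "w (int n + 1)" and ?b = "w (int n + 2)"
  have "(f has_arclength_integral (dist ?a ?b * c (int n + 2))) (linepath ?a ?b)"
    using Suc.prems[of "int n + 2"] edge_eq_open_segment[of w "int n + 2"] assms(1)[of "int n + 2"]
    by (intro has_arclength_integral_linepath_const) (auto simp: algebra_simps)
  moreover have "(f has_arclength_integral (\<Sum>j = 1..int n + 1. edge_length w j * c j)) (vertex_path w n)"
    using Suc.prems by (intro Suc.IH) auto
  ultimately show ?case
    unfolding last_edge_split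
    by (auto dest: has_arclength_integral_join simp: edge_length_def algebra_simps)
qed

lemma sum_edge_indicator:
  assumes poly: "polygon N w" and j: "j \<in> {1..int N}" and x: "x \<in> edge w j"
  shows "(\<Sum>k = 1..int N. g k * indicator (edge w k) x) = (g j :: real)"
proof -
  have "x \<notin> edge w k" if "k \<in> {1..int N} - {j}" for k
    using polygon_edge_disjoint[OF poly j, of k] edge_subset_closed_segment[of w k] that x by auto
  then have "(\<Sum>k\<in>{1..int N} - {j}. g k * indicator (edge w k) x) = 0"
    by (intro sum.neutral) simp
  with sum.remove[OF _ j, of "\<lambda>k. g k * indicator (edge w k) x"] x show ?thesis
    by (simp only: finite_atLeastAtMost_int) simp
qed

section \<open>The first variation of the perimeter\<close>

lemma sum_shift_periodic:
  fixes f :: "int \<Rightarrow> 'a::ab_group_add"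
  assumes "f (int N) = f 0"
  shows "(\<Sum>j = 1..int N. f (j - 1)) = (\<Sum>j = 1..int N. f j)"
proof -
  have "(\<Sum>j = 1..int N. f j - f (j - 1)) = f (int N) - f 0"
  proof (induction N)
    case (Suc N)
    have "{1..int (Suc N)} = insert (int N + 1) {1..int N}" by auto
    with Suc show ?case by (simp add: add.commute)
  qed simp
  then show ?thesis
    using assms by (simp add: sum_subtractf)
qed

theorem proposition2p3:
  fixes N :: nat and w\<^sub>0 :: "int \<Rightarrow> complex"
    and I :: "real set" and w :: "real \<Rightarrow> int \<Rightarrow> complex" and t :: real
  assumes "polygon N w\<^sub>0"
    and "is_interval I" and "interior I \<noteq> {}"
    and "C1_motion N w\<^sub>0 I w"
    and "t \<in> I"
  shows "((\<lambda>s. perimeter N (w s)) has_real_derivative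
            (\<Sum>j = 1..int N. edge_length (w t) j * edge_curvature N (w t) j * edge_velocity N I w t j))
           (at t within I)
       \<and> ((\<lambda>x. curvature N (w t) x * normal_velocity N I w t x) has_arclength_integral
            (\<Sum>j = 1..int N. edge_length (w t) j * edge_curvature N (w t) j * edge_velocity N I w t j))
           (polygon_path N (w t))"
proof -
  define T n \<phi> L v V where "T = tangent (w t)" and "n = outward_normal N (w t)"
    and "\<phi> = outer_angle N (w t)" and "L = (\<lambda>s. edge_length (w s))"
    and "v = vertex_velocity I w t" and "V = (\<lambda>j. v j \<bullet> n j)"
  have poly: "polygon N (w s)"
    and normals: "outward_normal N (w s) j = outward_normal N w\<^sub>0 j" if "s \<in> I" for s j
    using assms(4) that by (auto simp: C1_motion_def polygon_class_def)
  note polyt = poly[OF assms(5)]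
  have "I \<noteq> {x}" for x
    using assms(3) by auto
  then have "t islimpt I"
    using assms(2,5) by (intro connected_imp_perfect) (auto simp: is_interval_connected)
  then have not_bot: "at t within I \<noteq> bot"
    by (simp add: trivial_limit_within)
  have deriv: "((\<lambda>s. w s j) has_vector_derivative v j) (at t within I)" for j
  proof -
    obtain D where D: "((\<lambda>s. w s j) has_vector_derivative D t) (at t within I)"
      using assms(4,5) unfolding C1_motion_def by blast
    then show ?thesis
      using vector_derivative_within[OF not_bot D] by (simp add: v_def vertex_velocity_def)
  qed
  have T_const: "tangent (w s) j = T j" if "s \<in> I" for s j
  proof -
    have "outward_normal N (w s) j = outward_normal N (w t) j"
      using normals that assms(5) by simp
    then show ?thesis
      by (simp add: outward_normal_eq poly that assms(5) T_def)
  qed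
  have edge: "w s j - w s (j - 1) = L s j *\<^sub>R T j" if "s \<in> I" for s j
    using edge_vector[of "w s" j] T_const[OF that] by (simp add: L_def)
  have T_norm: "T j \<bullet> T j = 1" for j
    using norm_tangent[of "w t" j] polygon_vertices_distinct[OF polyt]
    by (simp add: T_def dot_square_norm)
  have n_T: "n j = - (\<i> * T j)" for j
    by (simp add: n_def T_def outward_normal_eq[OF polyt])
  have inner_deriv: "((\<lambda>s. (w s j - w s (j - 1)) \<bullet> a) has_real_derivative (v j - v (j - 1)) \<bullet> a)
      (at t within I)" for j a
    unfolding has_real_derivative_iff_has_vector_derivative
    by (intro bounded_linear.has_vector_derivative[OF bounded_linear_inner_left]
        has_vector_derivative_diff deriv)
  \<comment> \<open>The edge vector stays orthogonal to its normal, so both end points have the same normal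
    velocity.\<close>
  have v_n: "v (j - 1) \<bullet> n j = v j \<bullet> n j" for j
  proof -
    have "((\<lambda>s. 0) has_real_derivative (v j - v (j - 1)) \<bullet> n j) (at t within I)"
      by (rule has_field_derivative_transform_within[OF inner_deriv zero_less_one assms(5)])
         (simp add: edge n_T inner_complex_def)
    then have "((\<lambda>s. 0::real) has_vector_derivative (v j - v (j - 1)) \<bullet> n j) (at t within I)"
      by (simp add: has_real_derivative_iff_has_vector_derivative)
    from vector_derivative_unique_within[OF not_bot this has_vector_derivative_const]
    show ?thesis by (simp add: inner_diff_left)
  qed
  have V: "edge_velocity N I w t j = V j" for j
  proof -
    have pv: "point_velocity N I w t j \<theta> = V j" for \<theta>
      using v_n[of j] by (simp add: point_velocity_def V_def v_def n_def algebra_simps)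
    have "\<exists>\<theta>::real. 0 < \<theta> \<and> \<theta> < 1"
      by (rule exI[of _ "1/2"]) simp
    then show ?thesis
      unfolding edge_velocity_def pv by (intro the_equality) auto
  qed
  have L_pos: "L t j > 0" for j
    using polygon_vertices_distinct[OF polyt] by (simp add: L_def edge_length_def)
  have T_per: "T (j + int N) = T j" for j
    using polygon_periodic[OF polyt, of j] polygon_periodic[OF polyt, of "j - 1"]
    by (simp add: T_def tangent_def edge_length_def algebra_simps)
  have v_per: "v (j + int N) = v j" for j
  proof -
    have "((\<lambda>s. w s j) has_vector_derivative v (j + int N)) (at t within I)"
      by (rule has_vector_derivative_transform_within[OF deriv zero_less_one assms(5)])
         (simp add: polygon_periodic poly)
    from vector_derivative_unique_within[OF not_bot this deriv] show ?thesis .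
  qed
  have phi_per: "\<phi> (j + int N) = \<phi> j" for j
    using T_per[of j] T_per[of "j + 1"]
    by (simp add: \<phi>_def outer_angle_polygon(1)[OF polyt] T_def algebra_simps)
  have "(\<Sum>j = 1..int N. edge_length (w t) j * edge_curvature N (w t) j * edge_velocity N I w t j)
      = (\<Sum>j = 1..int N. (tan (\<phi> j / 2) + tan (\<phi> (j - 1) / 2)) * V j)"
    using L_pos by (intro sum.cong) (auto simp: V edge_curvature_def L_def \<phi>_def less_imp_neq[THEN not_sym])
  \<comment> \<open>The argument \<open>j - 1 + 1\<close> exhibits the second summand as a function of \<open>j - 1\<close>.\<close>
  also have "\<dots> = (\<Sum>j = 1..int N. tan (\<phi> j / 2) * V j)
      + (\<Sum>j = 1..int N. tan (\<phi> (j - 1) / 2) * V (j - 1 + 1))"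
    by (simp add: algebra_simps sum.distrib)
  also have "(\<Sum>j = 1..int N. tan (\<phi> (j - 1) / 2) * V (j - 1 + 1)) = (\<Sum>j = 1..int N. tan (\<phi> j / 2) * V (j + 1))"
    using phi_per[of 0] v_per[of 1] T_per[of 1]
    by (intro sum_shift_periodic[where f = "\<lambda>j. tan (\<phi> j / 2) * V (j + 1)"])
       (simp add: V_def n_T algebra_simps)
  \<comment> \<open>\<open>V (j + 1)\<close> is the normal velocity at the initial vertex \<open>w j\<close> of edge \<open>j + 1\<close>, so both terms are
    inner products with \<open>v j\<close>.\<close>
  also have "(\<Sum>j = 1..int N. tan (\<phi> j / 2) * V j) + \<dots>
      = (\<Sum>j = 1..int N. v j \<bullet> (tan (\<phi> j / 2) *\<^sub>R (n j + n (j + 1))))"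
    unfolding sum.distrib[symmetric]
  proof (rule sum.cong)
    fix j
    show "tan (\<phi> j / 2) * V j + tan (\<phi> j / 2) * V (j + 1) = v j \<bullet> (tan (\<phi> j / 2) *\<^sub>R (n j + n (j + 1)))"
      using v_n[of "j + 1"] by (simp add: V_def inner_add_right algebra_simps)
  qed simp
  also have "\<dots> = (\<Sum>j = 1..int N. v j \<bullet> T j) - (\<Sum>j = 1..int N. v j \<bullet> T (j + 1))"
    unfolding \<phi>_def n_def tan_half_angle_normals[OF polyt]
    by (simp add: T_def inner_diff_right sum_subtractf)
  also have "(\<Sum>j = 1..int N. v j \<bullet> T (j + 1)) = (\<Sum>j = 1..int N. v (j - 1) \<bullet> T j)"
    using sum_shift_periodic[of "\<lambda>j. v j \<bullet> T (j + 1)" N] v_per[of 0] T_per[of 1]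
    by (simp add: algebra_simps)
  also have "(\<Sum>j = 1..int N. v j \<bullet> T j) - \<dots> = (\<Sum>j = 1..int N. (v j - v (j - 1)) \<bullet> T j)"
    by (simp add: inner_diff_left sum_subtractf)
  finally have total: "(\<Sum>j = 1..int N. edge_length (w t) j * edge_curvature N (w t) j * edge_velocity N I w t j)
      = (\<Sum>j = 1..int N. (v j - v (j - 1)) \<bullet> T j)" .
  have "((\<lambda>s. \<Sum>j = 1..int N. (w s j - w s (j - 1)) \<bullet> T j) has_real_derivative
      (\<Sum>j = 1..int N. (v j - v (j - 1)) \<bullet> T j)) (at t within I)"
    by (intro DERIV_sum inner_deriv)
  then have "((\<lambda>s. perimeter N (w s)) has_real_derivative
      (\<Sum>j = 1..int N. (v j - v (j - 1)) \<bullet> T j)) (at t within I)"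
    by (rule has_field_derivative_transform_within[OF _ zero_less_one assms(5)])
       (simp add: edge T_norm perimeter_def L_def)
  moreover have "((\<lambda>x. curvature N (w t) x * normal_velocity N I w t x) has_arclength_integral
      (\<Sum>j = 1..int N. edge_length (w t) j * (edge_curvature N (w t) j * edge_velocity N I w t j)))
      (polygon_path N (w t))"
    unfolding polygon_path_def polygon_edges[OF polyt, symmetric]
  proof (rule has_arclength_integral_vertex_path)
    fix j x
    assume "j \<in> {1..int (N - 1) + 1}" and x: "x \<in> edge (w t) j"
    then have "j \<in> {1..int N}"
      by (simp only: polygon_edges[OF polyt])
    then show "curvature N (w t) x * normal_velocity N I w t x
        = edge_curvature N (w t) j * edge_velocity N I w t j"
      using x by (simp only: curvature_def normal_velocity_def sum_edge_indicator[OF polyt])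
  qed (rule polygon_vertices_distinct[OF polyt])
  ultimately show ?thesis
    unfolding total[symmetric] mult.assoc[symmetric] by (rule conjI)
qed

end
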